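(* Let $p\in\mathbb{R}\langle x\rangle$ be a symmetric nc polynomial and let $\mathcal{O}=(\mathcal{O}(n))_{n\in\mathbb{N}}$ be a nonempty nc basic open semialgebraic set. If $p$ is convex on $\mathcal{O}$, then $p$ has degree at most two.
   Context: $\mathbb{R}\langle x\rangle$ is the free associative $\mathbb{R}$-algebra in noncommuting variables $x=(x_1,\dots,x_g)$; its elements are nc polynomials and the degree of a nonzero nc polynomial is the length of the longest word appearing in it. It carries the linear involution ${}^\intercal$ that reverses words (with $x_j^\intercal=x_j$); $p$ is symmetric if $p^\intercal=p$. $\mathbb{S}^{n\times n}$ denotes the real symmetric $n\times n$ matrices. For $X=(X_1,\dots,X_g)\in(\mathbb{S}^{n\times n})^g$, $p(X)$ is the $n\times n$ matrix obtained by replacing $x_j$ by $X_j$ (the empty word evaluates to $I_n$). $A\succeq0$ (resp. $A\succ 0$) means positive semidefinite (resp. positive definite). An nc basic open semialgebraic set is a sequence $\mathcal{O}=(\mathcal{O}(n))_{n}$ with $\mathcal{O}(n)=\{X\in(\mathbb{S}^{n\times n})^g: p_1(X)\succ0,\dots,p_k(X)\succ0\}$ for some fixed symmetric nc polynomials $p_1,\dots,p_k$; it is nonempty if $\mathcal{O}(n)\neq\emptyset$ for some $n$. A symmetric polynomial $p$ is convex on $\mathcal{O}$ if for each $n$, all $X,Y\in\mathcal{O}(n)$ for which the segment joining $X$ and $Y$ lies in $\mathcal{O}(n)$, and all $0\le t\le1$, $tp(X)+(1-t)p(Y)-p(tX+(1-t)Y)\succeq0$. Equivalently, $p''(X)[H]\succeq0$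 for all $n$, $X\in\mathcal{O}(n)$, $H\in(\mathbb{S}^{n\times n})^g$, where $p''(X)[H]=\frac{d^2}{dt^2}p(X+tH)\big|_{t=0}$. *)

theory Defs
  imports Jordan_Normal_Form.Matrix "HOL-Library.Poly_Mapping"
begin

text \<open>A word in the letters \<open>x\<^sub>j\<close>, \<open>j :: 'g\<close>, is a list of letters, and an nc polynomial is a
  finitely supported family of real coefficients indexed by words. The vector space structure is
  the one of \<^typ>\<open>'g list \<Rightarrow>\<^sub>0 real\<close>; the finite type \<^typ>\<open>'g\<close> plays the role of
  \<open>{1, \<dots>, g}\<close>.\<close>

type_synonym 'g ncpoly = "'g list \<Rightarrow>\<^sub>0 real"

text \<open>Reversal is an involution on words, so reindexing along \<^const>\<open>rev\<close> replaces each word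
  by its reversal.\<close>

definition nc_invol :: "'g ncpoly \<Rightarrow> 'g ncpoly" where
  "nc_invol p = Poly_Mapping.map_key rev p"

lemma lookup_nc_invol: "Poly_Mapping.lookup (nc_invol p) w = Poly_Mapping.lookup p (rev w)"
  by (simp add: nc_invol_def Poly_Mapping.map_key.rep_eq)

lemma nc_invol_single: "nc_invol (Poly_Mapping.single w c) = Poly_Mapping.single (rev w) c"
  by (rule poly_mapping_eqI) (auto simp: lookup_nc_invol lookup_single when_def)

definition nc_symmetric :: "'g ncpoly \<Rightarrow> bool" where
  "nc_symmetric p \<longleftrightarrow> nc_invol p = p"

text \<open>The degree of the zero polynomial is set to \<open>0\<close> by convention.\<close>

definition nc_degree :: "'g ncpoly \<Rightarrow> nat" where
  "nc_degree p = (if p = 0 then 0 else Max (length ` Poly_Mapping.keys p))"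

definition sym_tuples :: "nat \<Rightarrow> ('g \<Rightarrow> real mat) set" where
  "sym_tuples n = {X. \<forall>j. X j \<in> carrier_mat n n \<and> transpose_mat (X j) = X j}"

definition word_eval :: "nat \<Rightarrow> ('g \<Rightarrow> real mat) \<Rightarrow> 'g list \<Rightarrow> real mat" where
  "word_eval n X w = foldr (\<lambda>j M. X j * M) w (1\<^sub>m n)"

text \<open>The linear combination of words is formed entrywise, since matrices of unspecified
  dimension do not form a commutative monoid.\<close>

definition nc_eval :: "nat \<Rightarrow> 'g ncpoly \<Rightarrow> ('g \<Rightarrow> real mat) \<Rightarrow> real mat" where
  "nc_eval n p X = mat n n (\<lambda>(i, j). \<Sum>w\<in>Poly_Mapping.keys p. Poly_Mapping.lookup p w * word_eval n X w $$ (i, j))"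

definition psd :: "nat \<Rightarrow> real mat \<Rightarrow> bool" where
  "psd n A \<longleftrightarrow> A \<in> carrier_mat n n \<and> transpose_mat A = A \<and>
     (\<forall>v\<in>carrier_vec n. v \<bullet> (A *\<^sub>v v) \<ge> 0)"

definition pd :: "nat \<Rightarrow> real mat \<Rightarrow> bool" where
  "pd n A \<longleftrightarrow> A \<in> carrier_mat n n \<and> transpose_mat A = A \<and>
     (\<forall>v\<in>carrier_vec n. v \<noteq> 0\<^sub>v n \<longrightarrow> v \<bullet> (A *\<^sub>v v) > 0)"

text \<open>Matrix sizes are positive throughout. This matters: a matrix of size \<open>0\<close> is vacuously
  positive definite, so level \<open>0\<close> would make every basic open set nonempty. The value of the
  sequence at \<open>0\<close> is irrelevant.\<close>

definition nc_basic_open :: "(nat \<Rightarrow> ('g \<Rightarrow> real mat) set) \<Rightarrow> bool" where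
  "nc_basic_open \<O> \<longleftrightarrow> (\<exists>ps :: 'g ncpoly list. (\<forall>q\<in>set ps. nc_symmetric q) \<and>
     (\<forall>n>0. \<O> n = {X \<in> sym_tuples n. \<forall>q\<in>set ps. pd n (nc_eval n q X)}))"

definition nc_nonempty :: "(nat \<Rightarrow> ('g \<Rightarrow> real mat) set) \<Rightarrow> bool" where
  "nc_nonempty \<O> \<longleftrightarrow> (\<exists>n>0. \<O> n \<noteq> {})"

definition conv_comb :: "real \<Rightarrow> ('g \<Rightarrow> real mat) \<Rightarrow> ('g \<Rightarrow> real mat) \<Rightarrow> 'g \<Rightarrow> real mat" where
  "conv_comb t X Y = (\<lambda>j. t \<cdot>\<^sub>m X j + (1 - t) \<cdot>\<^sub>m Y j)"

definition nc_convex_on :: "'g ncpoly \<Rightarrow> (nat \<Rightarrow> ('g \<Rightarrow> real mat) set) \<Rightarrow> bool" where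
  "nc_convex_on p \<O> \<longleftrightarrow> (\<forall>n>0. \<forall>X\<in>\<O> n. \<forall>Y\<in>\<O> n.
     (\<forall>s\<in>{0..1}. conv_comb s X Y \<in> \<O> n) \<longrightarrow>
     (\<forall>t\<in>{0..1}. psd n (t \<cdot>\<^sub>m nc_eval n p X + (1 - t) \<cdot>\<^sub>m nc_eval n p Y
        - nc_eval n p (conv_comb t X Y))))"

end

theory Submission
  imports Defs "HOL-Analysis.Function_Topology"
begin

text \<open>
  Suppose that \<open>p\<close> has degree \<open>d \<ge> 3\<close> and let \<open>w\<close> be a word of length \<open>d\<close> in \<open>p\<close>. The word is
  written around a cycle with vertices \<open>0, \<dots>, d - 1\<close>: the edge from \<open>k\<close> to \<open>k + 1\<close> carries the
  letter \<open>w ! (d - 1 - k)\<close> and a weight \<open>c k\<close>, and the edge that closes the cycle, from \<open>d - 1\<close>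
  to \<open>0\<close>, carries the letter \<open>w ! 0\<close> and a weight \<open>b\<close>. The letters are listed backwards because
  a product of matrices applies its last factor first, so that \<open>w\<close> is read off by going once
  around from \<open>0\<close> in increasing order. Let \<open>S\<^sub>j\<close> be the symmetric weighted adjacency matrix of the
  edges with letter \<open>j\<close>. For a point \<open>X\<close> of \<open>\<O>\<close> of size \<open>n\<close>, the Kronecker sums
  \<open>Y\<^sub>j = I \<otimes> X\<^sub>j + S\<^sub>j \<otimes> I\<close> form a tuple of size \<open>d n\<close>. At weight zero it is a
  direct sum of copies of \<open>X\<close>, hence in \<open>\<O>\<close>, and since positive definiteness is an open condition
  it stays in \<open>\<O>\<close> for small weights (\<open>cycle_tuples_in_nc_basic_open\<close>).

  The top left entry of \<open>p(Y)\<close> is a sum over closed walks at vertex \<open>0\<close> with at most \<open>d\<close> steps on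
  the cycle; the steps that stay at their vertex come from \<open>X\<close>. Take all weights on the path
  \<open>0, \<dots>, d - 2\<close> equal to a small \<open>\<alpha> > 0\<close>, and let the two edges at the vertex \<open>d - 1\<close> have
  weights \<open>\<gamma>\<close> and \<open>b\<close>. Write \<open>f \<gamma> b\<close> for the entry.

  \<^item> For \<open>b = 0\<close> the cycle is cut open, and a walk that uses the edge of weight \<open>\<gamma>\<close> has to return
    along the path, so it needs \<open>2 (d - 1)\<close> steps. This exceeds \<open>d\<close> precisely because \<open>d > 2\<close>. Hence
    \<open>f \<gamma> 0\<close> does not depend on \<open>\<gamma>\<close> (\<open>walk_sum_last_edge_irrelevant\<close>).
  \<^item> The terms of first order in \<open>b\<close> come from closed walks that use the closing edge once. They
    must go once around, in one of the two directions, and then they spell \<open>w\<close> or its reversal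
    without a spare step. By symmetry of \<open>p\<close> both words have the same coefficient \<open>p\<^sub>w\<close>, so the
    derivative of \<open>f \<gamma>\<close> at \<open>b = 0\<close> is \<open>2 p\<^sub>w \<gamma> \<alpha>\<^bsup>d - 2\<^esup>\<close> (\<open>closing_derivative_sum\<close>).

  The tuple with weights \<open>(0, 0)\<close> for \<open>(\<gamma>, b)\<close> is the midpoint of those with weights \<open>(\<alpha>, b)\<close> and
  \<open>(-\<alpha>, -b)\<close>, so convexity says that \<open>f \<alpha> b + f (-\<alpha>) (-b) - 2 f 0 0 \<ge> 0\<close> for all small \<open>b\<close>.
  The left side vanishes at \<open>b = 0\<close>, which is thus a minimum, yet its derivative there is
  \<open>4 p\<^sub>w \<alpha>\<^bsup>d - 1\<^esup> \<noteq> 0\<close>: a contradiction.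
\<close>

section \<open>Walks on a labelled cycle\<close>

definition cycle_adj :: "'g list \<Rightarrow> (nat \<Rightarrow> real) \<Rightarrow> real \<Rightarrow> 'g \<Rightarrow> nat \<Rightarrow> nat \<Rightarrow> real" where
  "cycle_adj w c b l i j =
     (if i = Suc j \<and> l = w ! (length w - i) then c j else 0)
   + (if j = Suc i \<and> l = w ! (length w - j) then c i else 0)
   + (if i = 0 \<and> j = length w - 1 \<and> l = w ! 0 then b else 0)
   + (if i = length w - 1 \<and> j = 0 \<and> l = w ! 0 then b else 0)"

text \<open>The entries, in the column of vertex \<open>0\<close> and coordinate \<open>0\<close>, of the evaluation of a word at
  the Kronecker sums of the matrices \<open>A l\<close> of size \<open>n\<close> with the adjacency matrices of the cycle; the
  row is split into a vertex \<open>k\<close> and a coordinate \<open>a\<close>. Each letter, read from the end of the word,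
  either acts by \<open>A l\<close> at the current vertex or moves along an edge with that letter.\<close>

primrec walk_sum ::
  "('g \<Rightarrow> nat \<Rightarrow> nat \<Rightarrow> real) \<Rightarrow> nat \<Rightarrow> 'g list \<Rightarrow> (nat \<Rightarrow> real) \<Rightarrow> real \<Rightarrow> 'g list \<Rightarrow> nat \<Rightarrow> nat \<Rightarrow> real"
  where
    "walk_sum A n w c b [] = (\<lambda>k a. if k = 0 \<and> a = 0 then 1 else 0)"
  | "walk_sum A n w c b (l # u) = (\<lambda>k a.
        (\<Sum>a'<n. A l a a' * walk_sum A n w c b u k a')
      + (\<Sum>k'<length w. cycle_adj w c b l k k' * walk_sum A n w c b u k' a))"

lemma cycle_adj_sum:
  assumes "k < length w"
  shows "(\<Sum>k'<length w. cycle_adj w c b l k k' * f k') =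
      (if 0 < k \<and> l = w ! (length w - k) then c (k - 1) * f (k - 1) else 0)
    + (if Suc k < length w \<and> l = w ! (length w - Suc k) then c k * f (Suc k) else 0)
    + (if k = 0 \<and> l = w ! 0 then b * f (length w - 1) else 0)
    + (if k = length w - 1 \<and> l = w ! 0 then b * f 0 else 0)"
proof -
  let ?d = "length w"
  have 1: "(\<Sum>k'<?d. (if k = Suc k' \<and> l = w ! (?d - k) then c k' else 0) * f k')
      = (\<Sum>k'<?d. if k' = k - 1 then (if 0 < k \<and> l = w ! (?d - k) then c (k - 1) * f (k - 1) else 0) else 0)"
    by (rule sum.cong) auto
  have 2: "(\<Sum>k'<?d. (if k' = Suc k \<and> l = w ! (?d - k') then c k else 0) * f k')
      = (\<Sum>k'<?d. if k' = Suc k then (if l = w ! (?d - Suc k) then c k * f (Suc k) else 0) else 0)"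
    by (rule sum.cong) auto
  have 3: "(\<Sum>k'<?d. (if k = 0 \<and> k' = ?d - 1 \<and> l = w ! 0 then b else 0) * f k')
      = (\<Sum>k'<?d. if k' = ?d - 1 then (if k = 0 \<and> l = w ! 0 then b * f (?d - 1) else 0) else 0)"
    by (rule sum.cong) auto
  have 4: "(\<Sum>k'<?d. (if k = ?d - 1 \<and> k' = 0 \<and> l = w ! 0 then b else 0) * f k')
      = (\<Sum>k'<?d. if k' = 0 then (if k = ?d - 1 \<and> l = w ! 0 then b * f 0 else 0) else 0)"
    by (rule sum.cong) auto
  show ?thesis
    unfolding cycle_adj_def distrib_right sum.distrib 1 2 3 4 sum.delta[OF finite_lessThan]
    using assms by (intro arg_cong2[where f = "(+)"]) auto
qed

lemma walk_sum_Cons: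
  assumes "k < length w"
  shows "walk_sum A n w c b (l # u) k a =
      (\<Sum>a'<n. A l a a' * walk_sum A n w c b u k a')
    + (if 0 < k \<and> l = w ! (length w - k) then c (k - 1) * walk_sum A n w c b u (k - 1) a else 0)
    + (if Suc k < length w \<and> l = w ! (length w - Suc k) then c k * walk_sum A n w c b u (Suc k) a else 0)
    + (if k = 0 \<and> l = w ! 0 then b * walk_sum A n w c b u (length w - 1) a else 0)
    + (if k = length w - 1 \<and> l = w ! 0 then b * walk_sum A n w c b u 0 a else 0)"
  by (simp add: cycle_adj_sum[OF assms, where f = "\<lambda>k'. walk_sum A n w c b u k' a"])

declare walk_sum.simps(2) [simp del]

text \<open>Without the closing edge, vertex \<open>k\<close> has distance \<open>k\<close> from the start. A walk of that length has
  no step to spare, so it climbs the path and spells the last \<open>k\<close> letters of \<open>w\<close>.\<close>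

lemma walk_sum_open_path:
  assumes "k < length w" "length u \<le> k"
  shows "walk_sum A n w c 0 u k a =
     (if u = drop (length w - k) w \<and> a = 0 then \<Prod>j<k. c j else 0)"
  using assms
proof (induction u arbitrary: k a)
  case Nil
  then show ?case by auto
next
  case (Cons l u)
  then obtain m where k: "k = Suc m" by (cases k) auto
  have a: "walk_sum A n w c 0 u k a' = 0" for a'
    using Cons.IH[of k a'] Cons.prems by auto
  have b: "walk_sum A n w c 0 u (Suc k) a = 0" if "Suc k < length w"
    using Cons.IH[of "Suc k" a] Cons.prems that by auto
  have "drop (length w - k) w = w ! (length w - k) # drop (length w - m) w"
    using Cons.prems k by (subst Cons_nth_drop_Suc[symmetric]) (auto simp: Suc_diff_Suc)
  then have match: "l # u = drop (length w - k) w \<longleftrightarrow> l = w ! (length w - k) \<and> u = drop (length w - m) w"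
    by simp
  have "walk_sum A n w c 0 (l # u) k a
      = (if l = w ! (length w - k) then c m * walk_sum A n w c 0 u m a else 0)"
    using Cons.prems(1) a b k by (simp add: walk_sum_Cons)
  also have "walk_sum A n w c 0 u m a
      = (if u = drop (length w - m) w \<and> a = 0 then \<Prod>j<m. c j else 0)"
    using Cons.IH[of m a] Cons.prems k by simp
  finally show ?case
    unfolding match by (simp add: k lessThan_Suc)
qed

text \<open>A walk that crosses the edge between \<open>length w - 2\<close> and \<open>length w - 1\<close> and ends at \<open>k\<close> has to
  reach the far end of the path and come back, which takes \<open>2 * (length w - 1) - k\<close> steps.\<close>

lemma walk_sum_last_edge_irrelevant:
  assumes "\<And>j. j < length w - 2 \<Longrightarrow> c j = c' j"
    and "k < length w" "length u + k < 2 * (length w - 1)"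
  shows "walk_sum A n w c 0 u k a = walk_sum A n w c' 0 u k a"
  using assms(2,3)
proof (induction u arbitrary: k a)
  case Nil
  then show ?case by simp
next
  case (Cons l u)
  let ?d = "length w"
  have a: "walk_sum A n w c 0 u k a' = walk_sum A n w c' 0 u k a'" for a'
    using Cons.IH[of k a'] Cons.prems by auto
  have b: "c (k - 1) * walk_sum A n w c 0 u (k - 1) a = c' (k - 1) * walk_sum A n w c' 0 u (k - 1) a"
    if "0 < k"
  proof (cases "k = ?d - 1")
    case True
    have "length u < k - 1" using Cons.prems True by auto
    then show ?thesis using walk_sum_open_path[of "k - 1" w u A n _ a] Cons.prems by auto
  next
    case False
    then show ?thesis using Cons.IH[of "k - 1" a] Cons.prems assms(1)[of "k - 1"] that by auto
  qed
  have c: "c k * walk_sum A n w c 0 u (Suc k) a = c' k * walk_sum A n w c' 0 u (Suc k) a"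
    if "Suc k < ?d"
  proof (cases "Suc k = ?d - 1")
    case True
    have "length u < Suc k" using Cons.prems True by auto
    then show ?thesis using walk_sum_open_path[of "Suc k" w u A n _ a] that by auto
  next
    case False
    then show ?thesis using Cons.IH[of "Suc k" a] Cons.prems assms(1)[of "k"] that by auto
  qed
  show ?case
    using Cons.prems(1) a b c by (simp add: walk_sum_Cons)
qed

lemma walk_sum_continuous: "continuous_on UNIV (\<lambda>b. walk_sum A n w c b u k a)"
proof (induction u arbitrary: k a)
  case Nil
  then show ?case by simp
next
  case (Cons l u)
  have "continuous_on UNIV (\<lambda>b::real. if P then b else 0)" for P
    by (cases P) auto
  then show ?case
    unfolding walk_sum.simps cycle_adj_def
    by (intro continuous_intros Cons.IH)
qed

lemma DERIV_mult_self_0: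
  fixes f :: "real \<Rightarrow> real"
  assumes "isCont f 0"
  shows "((\<lambda>b. b * f b) has_real_derivative f 0) (at 0)"
  unfolding CARAT_DERIV using assms by (intro exI[of _ f]) simp

text \<open>The first order term in the weight of the closing edge counts the walks that cross this edge
  once. Crossing it from \<open>0\<close> and descending the path to \<open>k\<close> takes at least \<open>length w - k\<close> steps, and
  a walk that short spells an initial segment of \<open>w\<close> backwards. Climbing the path first and then
  crossing takes at least \<open>length w\<close> steps, so within the given length it ends at \<open>0\<close> and spells
  \<open>w\<close>.\<close>

lemma walk_sum_closing_derivative:
  assumes "k < length w" "length u + k \<le> length w" "2 \<le> length w"
  shows "((\<lambda>b. walk_sum A n w c b u k a) has_real_derivative
      (if length u + k < length w \<or> a \<noteq> 0 then 0
       else (if rev u = take (length w - k) w then \<Prod>j=k..<length w - 1. c j else 0)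
          + (if k = 0 \<and> u = w then \<Prod>j<length w - 1. c j else 0))) (at 0)"
  using assms(1,2)
proof (induction u arbitrary: k a)
  case Nil
  then show ?case by simp
next
  case (Cons l u)
  let ?d = "length w" and ?T = "walk_sum A n w c"
  let ?D = "\<lambda>u k a. (if length u + k < ?d \<or> a \<noteq> 0 then 0
       else (if rev u = take (?d - k) w then \<Prod>j=k..<?d - 1. c j else 0)
          + (if k = 0 \<and> u = w then \<Prod>j<?d - 1. c j else 0))"
  have cont: "isCont (\<lambda>b. ?T b u k' a) 0" for k'
    using walk_sum_continuous by (metis UNIV_I continuous_on_eq_continuous_at open_UNIV)
  have if_deriv: "((\<lambda>b. if P then f b else 0) has_real_derivative (if P then D else 0)) (at 0)"
    if "P \<Longrightarrow> (f has_real_derivative D) (at 0)" for P and f :: "real \<Rightarrow> real" and D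
    using that by (cases P) auto
  have "((\<lambda>b. ?T b (l # u) k a) has_real_derivative
      (\<Sum>a'<n. A l a a' * 0)
    + (if 0 < k \<and> l = w ! (?d - k) then c (k - 1) * 0 else 0)
    + (if Suc k < ?d \<and> l = w ! (?d - Suc k) then c k * ?D u (Suc k) a else 0)
    + (if k = 0 \<and> l = w ! 0 then ?T 0 u (?d - 1) a else 0)
    + (if k = ?d - 1 \<and> l = w ! 0 then ?T 0 u 0 a else 0)) (at 0)"
    unfolding walk_sum_Cons[OF Cons.prems(1)]
  proof (intro DERIV_add DERIV_sum DERIV_cmult if_deriv DERIV_mult_self_0 cont)
    show "((\<lambda>b. ?T b u k a') has_real_derivative 0) (at 0)" for a'
      using Cons.IH[of k a'] Cons.prems by auto
    show "((\<lambda>b. ?T b u (k - 1) a) has_real_derivative 0) (at 0)" if "0 < k \<and> l = w ! (?d - k)"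
    proof -
      have "length u + (k - 1) < ?d" using Cons.prems that by simp
      then show ?thesis using Cons.IH[of "k - 1" a] by (simp add: less_imp_le)
    qed
    show "((\<lambda>b. ?T b u (Suc k) a) has_real_derivative ?D u (Suc k) a) (at 0)"
      if "Suc k < ?d \<and> l = w ! (?d - Suc k)"
      using Cons.IH[of "Suc k" a] Cons.prems that by auto
  qed
  moreover have "(\<Sum>a'<n. A l a a' * 0)
    + (if 0 < k \<and> l = w ! (?d - k) then c (k - 1) * 0 else 0)
    + (if Suc k < ?d \<and> l = w ! (?d - Suc k) then c k * ?D u (Suc k) a else 0)
    + (if k = 0 \<and> l = w ! 0 then ?T 0 u (?d - 1) a else 0)
    + (if k = ?d - 1 \<and> l = w ! 0 then ?T 0 u 0 a else 0) = ?D (l # u) k a"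
  proof -
    have w: "w = w ! 0 # drop 1 w"
      using assms(3) by (cases w) auto
    \<comment> \<open>The walk arrives at \<open>k\<close> by a step down the path, or by crossing the closing edge to either
      of its ends. The remaining ways to arrive have derivative zero.\<close>
    let ?up = "if Suc k < ?d \<and> l = w ! (?d - Suc k) then c k * ?D u (Suc k) a else 0"
    let ?first = "if k = ?d - 1 \<and> l = w ! 0 then ?T 0 u 0 a else 0"
    let ?last = "if k = 0 \<and> l = w ! 0 then ?T 0 u (?d - 1) a else 0"
    have last: "?last = (if k = 0 \<and> l # u = w \<and> a = 0 then \<Prod>j<?d - 1. c j else 0)"
    proof (cases "k = 0")
      case True
      have "?T 0 u (?d - 1) a = (if u = drop 1 w \<and> a = 0 then \<Prod>j<?d - 1. c j else 0)"
        using walk_sum_open_path[of "?d - 1" w u A n c a] Cons.prems True assms(3)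
        by simp
      moreover have "l # u = w \<longleftrightarrow> l = w ! 0 \<and> u = drop 1 w" by (subst w) simp
      ultimately show ?thesis using True by auto
    qed simp
    have first: "?first = (if k = ?d - 1 \<and> l # u = [w ! 0] \<and> a = 0 then 1 else 0)"
    proof (cases "k = ?d - 1")
      case True
      have "Suc (length u) + k \<le> ?d" using Cons.prems by simp
      then have "length u = 0" using True assms(3) by linarith
      then have "u = []" by simp
      then show ?thesis by auto
    qed simp
    have up: "?up + ?first = (if length (l # u) + k < ?d \<or> a \<noteq> 0 then 0
       else (if rev (l # u) = take (?d - k) w then \<Prod>j=k..<?d - 1. c j else 0))"
    proof (cases "Suc k < ?d")
      case True
      have "take (?d - k) w = take (?d - Suc k) w @ [w ! (?d - Suc k)]"
        using True by (metis Suc_diff_Suc Suc_lessD diff_less length_greater_0_conv take_Suc_conv_app_nth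
            list.size(3) not_less_zero zero_less_Suc)
      moreover have "(\<Prod>j=k..<?d - 1. c j) = c k * (\<Prod>j=Suc k..<?d - 1. c j)"
        using True by (simp add: prod.atLeast_Suc_lessThan)
      ultimately show ?thesis using True unfolding first by auto
    next
      case False
      then have k: "k = ?d - 1" using Cons.prems by auto
      have "Suc (length u) + k \<le> ?d" using Cons.prems by simp
      then have "length u = 0" using k assms(3) by linarith
      then have u: "u = []" by simp
      have "take (?d - k) w = [w ! 0]" using k assms(3) by (cases w) auto
      then show ?thesis using k u assms(3) unfolding first by auto
    qed
    have "(\<Sum>a'<n. A l a a' * 0)
      + (if 0 < k \<and> l = w ! (?d - k) then c (k - 1) * 0 else 0) + ?up + ?last + ?first
      = (?up + ?first) + ?last"
      by (simp only: mult_zero_right sum.neutral_const if_cancel add_0_left add.assoc add.commute add.left_commute)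
    also have "\<dots> = ?D (l # u) k a"
      unfolding up last by auto
    finally show ?thesis .
  qed
  ultimately show ?case by simp
qed

section \<open>Openness of positive definiteness\<close>

text \<open>The minimum over the unit sphere is positive because the sphere is compact. The sphere is
  realised inside a product of intervals, with all coordinates from \<open>n\<close> on equal to zero, so that
  the dimension can remain a variable.\<close>

lemma quadratic_form_coercive:
  fixes A :: "nat \<Rightarrow> nat \<Rightarrow> real"
  assumes pos: "\<And>x. \<exists>i<n. x i \<noteq> 0 \<Longrightarrow> 0 < (\<Sum>i<n. \<Sum>j<n. A i j * x i * x j)"
  shows "\<exists>c>0. \<forall>x. c * (\<Sum>i<n. (x i)\<^sup>2) \<le> (\<Sum>i<n. \<Sum>j<n. A i j * x i * x j)"
proof (cases "n = 0")
  case True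
  then show ?thesis by (intro exI[of _ 1]) simp
next
  case False
  let ?Q = "\<lambda>x. \<Sum>i<n. \<Sum>j<n. A i j * x i * x j" and ?N = "\<lambda>x. \<Sum>i<n. (x i)\<^sup>2"
  define I where "I i = (if i < n then {-1..1::real} else {0})" for i
  define K where "K = {x. \<forall>i. x i \<in> I i} \<inter> {x. ?N x = 1}"
  have "compactin (product_topology (\<lambda>_. euclidean) UNIV) (PiE UNIV I)"
    by (simp add: compactin_PiE I_def)
  then have "compact {x. \<forall>i. x i \<in> I i}"
    by (simp add: euclidean_product_topology PiE_UNIV_domain Pi_def)
  moreover have "closed {x :: nat \<Rightarrow> real. ?N x = 1}"
    by (intro closed_Collect_eq continuous_intros continuous_on_product_coordinates)
  ultimately have "compact K"
    unfolding K_def by (rule compact_Int_closed)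
  moreover have "(\<lambda>i. if i = 0 then 1 else 0) \<in> K"
  proof -
    have "(\<Sum>i<n. (if i = 0 then 1 else 0 :: real)\<^sup>2) = (\<Sum>i<n. if i = 0 then 1 else 0)"
      by (rule sum.cong) auto
    then show ?thesis using False by (auto simp: K_def I_def)
  qed
  moreover have "continuous_on K ?Q"
    by (intro continuous_intros continuous_on_subset[OF continuous_on_product_coordinates]) auto
  ultimately obtain z where z: "z \<in> K" "\<And>x. x \<in> K \<Longrightarrow> ?Q z \<le> ?Q x"
    using continuous_attains_inf[of K ?Q] by blast
  have "\<exists>i<n. z i \<noteq> 0"
  proof (rule ccontr)
    assume "\<not> ?thesis"
    then have "?N z = 0" by simp
    with z(1) show False by (simp add: K_def)
  qed
  then have "0 < ?Q z" by (rule pos)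
  moreover have "?Q z * ?N x \<le> ?Q x" for x
  proof (cases "\<exists>i<n. x i \<noteq> 0")
    case True
    define s where "s = sqrt (?N x)"
    obtain i where "i < n" "x i \<noteq> 0" using True by blast
    then have Npos: "0 < ?N x" by (intro sum_pos2[of "{..<n}" i]) auto
    then have s: "0 < s" "s\<^sup>2 = ?N x" by (auto simp: s_def)
    define y where "y i = (if i < n then x i / s else 0)" for i
    have Ny: "?N y = 1"
    proof -
      have "?N y = (\<Sum>i<n. (x i)\<^sup>2 / s\<^sup>2)" by (simp add: y_def power_divide)
      also have "\<dots> = ?N x / s\<^sup>2" by (simp add: sum_divide_distrib)
      finally show ?thesis using s Npos by simp
    qed
    have "y i \<in> I i" for i
    proof (cases "i < n")
      case True
      have "(y i)\<^sup>2 \<le> ?N y" using True by (intro member_le_sum) auto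
      then have "\<bar>y i\<bar> \<le> 1" using Ny by (simp add: abs_square_le_1)
      then show ?thesis using True by (auto simp: I_def)
    qed (simp add: I_def y_def)
    then have "?Q z \<le> ?Q y" using Ny by (intro z(2)) (simp add: K_def)
    also have "?Q y = (\<Sum>i<n. \<Sum>j<n. A i j * x i * x j / s\<^sup>2)"
      by (intro sum.cong) (auto simp: y_def power2_eq_square)
    also have "\<dots> = ?Q x / ?N x" by (simp add: sum_divide_distrib s)
    finally show ?thesis using Npos by (simp add: field_simps)
  qed simp
  ultimately show ?thesis by blast
qed

lemma pd_iff:
  assumes "A \<in> carrier_mat n n"
  shows "pd n A \<longleftrightarrow> (\<forall>i<n. \<forall>j<n. A $$ (i, j) = A $$ (j, i)) \<and>
    (\<forall>x. (\<exists>i<n. x i \<noteq> 0) \<longrightarrow> 0 < (\<Sum>i<n. \<Sum>j<n. A $$ (i, j) * x i * x j))"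
proof -
  have sym: "transpose_mat A = A \<longleftrightarrow> (\<forall>i<n. \<forall>j<n. A $$ (i, j) = A $$ (j, i))"
    using assms by (auto simp: mat_eq_iff)
  have form: "scalar_prod v (A *\<^sub>v v) = (\<Sum>i<n. \<Sum>j<n. A $$ (i, j) * v $ i * v $ j)"
    if "v \<in> carrier_vec n" for v
    using assms that
    by (auto simp: scalar_prod_def sum_distrib_left atLeast0LessThan intro!: sum.cong)
  show ?thesis
  proof
    assume *: "pd n A"
    show "(\<forall>i<n. \<forall>j<n. A $$ (i, j) = A $$ (j, i)) \<and>
      (\<forall>x. (\<exists>i<n. x i \<noteq> 0) \<longrightarrow> 0 < (\<Sum>i<n. \<Sum>j<n. A $$ (i, j) * x i * x j))"
    proof (intro conjI allI[where ?'a = "nat \<Rightarrow> real"] impI)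
      show "\<forall>i<n. \<forall>j<n. A $$ (i, j) = A $$ (j, i)" using * sym by (simp add: pd_def)
      fix x :: "nat \<Rightarrow> real" assume "\<exists>i<n. x i \<noteq> 0"
      then have "vec n x \<noteq> 0\<^sub>v n" by (auto simp: vec_eq_iff)
      then have "0 < scalar_prod (vec n x) (A *\<^sub>v vec n x)" using * by (simp add: pd_def)
      then show "0 < (\<Sum>i<n. \<Sum>j<n. A $$ (i, j) * x i * x j)" by (simp add: form)
    qed
  next
    assume *: "(\<forall>i<n. \<forall>j<n. A $$ (i, j) = A $$ (j, i)) \<and>
      (\<forall>x. (\<exists>i<n. x i \<noteq> 0) \<longrightarrow> 0 < (\<Sum>i<n. \<Sum>j<n. A $$ (i, j) * x i * x j))"
    have "0 < scalar_prod v (A *\<^sub>v v)" if "v \<in> carrier_vec n" "v \<noteq> 0\<^sub>v n" for v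
    proof -
      have "\<exists>i<n. v $ i \<noteq> 0" using that by (auto simp: vec_eq_iff)
      then show ?thesis using * form[OF that(1)] by simp
    qed
    then show "pd n A" using * assms sym by (simp add: pd_def)
  qed
qed

text \<open>Perturbing each entry by less than \<open>e\<close> changes the quadratic form by at most \<open>e * n\<close> times the
  squared norm, which coercivity absorbs.\<close>

lemma eventually_pd:
  fixes M :: "'a::t2_space \<Rightarrow> real mat"
  assumes M: "\<And>t. M t \<in> carrier_mat n n" "\<And>t. transpose_mat (M t) = M t"
    and cont: "\<And>i j. i < n \<Longrightarrow> j < n \<Longrightarrow> continuous_on UNIV (\<lambda>t. M t $$ (i, j))"
    and "pd n (M t0)"
  shows "\<forall>\<^sub>F t in nhds t0. pd n (M t)"
proof -
  obtain c where c: "c > 0"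
      "\<And>x. c * (\<Sum>i<n. (x i)\<^sup>2) \<le> (\<Sum>i<n. \<Sum>j<n. M t0 $$ (i, j) * x i * x j)"
    using quadratic_form_coercive[of n "\<lambda>i j. M t0 $$ (i, j)"] \<open>pd n (M t0)\<close> pd_iff[OF M(1)]
    by auto
  \<comment> \<open>The summand \<open>1\<close> avoids a division by zero and makes \<open>e * n\<close> strictly less than \<open>c\<close>.\<close>
  define e where "e = c / (n + 1)"
  have e: "e > 0" "e * n < c" using c(1) by (auto simp: e_def field_simps)
  have "\<forall>\<^sub>F t in nhds t0. dist (M t $$ (i, j)) (M t0 $$ (i, j)) < e" if "i < n" "j < n" for i j
  proof -
    have "isCont (\<lambda>t. M t $$ (i, j)) t0"
      using cont[OF that] by (simp add: continuous_on_eq_continuous_at)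
    then show ?thesis
      using e(1) by (simp add: isCont_def tendsto_at_iff_tendsto_nhds[of "\<lambda>t. M t $$ (i, j)"] tendstoD)
  qed
  then have "\<forall>\<^sub>F t in nhds t0. \<forall>i\<in>{..<n}. \<forall>j\<in>{..<n}. dist (M t $$ (i, j)) (M t0 $$ (i, j)) < e"
    by (intro eventually_ball_finite ballI) auto
  then show ?thesis
  proof (rule eventually_mono)
    fix t assume t: "\<forall>i\<in>{..<n}. \<forall>j\<in>{..<n}. dist (M t $$ (i, j)) (M t0 $$ (i, j)) < e"
    have "0 < (\<Sum>i<n. \<Sum>j<n. M t $$ (i, j) * x i * x j)" if nz: "\<exists>i<n. x i \<noteq> 0" for x
    proof -
      let ?N = "\<Sum>i<n. (x i)\<^sup>2"
      obtain i where "i < n" "x i \<noteq> 0" using nz by blast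
      then have N: "0 < ?N" by (intro sum_pos2[of "{..<n}" i]) auto
      have "(M t0 $$ (i, j) - M t $$ (i, j)) * x i * x j \<le> e * (((x i)\<^sup>2 + (x j)\<^sup>2) / 2)"
        if "i < n" "j < n" for i j
      proof -
        have "(M t0 $$ (i, j) - M t $$ (i, j)) * x i * x j \<le> \<bar>M t0 $$ (i, j) - M t $$ (i, j)\<bar> * \<bar>x i * x j\<bar>"
          by (metis abs_ge_self abs_mult mult.assoc)
        also have "\<dots> \<le> e * \<bar>x i * x j\<bar>"
          using t that by (intro mult_right_mono) (auto simp: dist_real_def abs_minus_commute less_imp_le)
        also have "\<dots> \<le> e * (((x i)\<^sup>2 + (x j)\<^sup>2) / 2)"
          using e(1) sum_squares_bound[of "\<bar>x i\<bar>" "\<bar>x j\<bar>"] by (intro mult_left_mono) (auto simp: abs_mult)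
        finally show ?thesis .
      qed
      then have "(\<Sum>i<n. \<Sum>j<n. (M t0 $$ (i, j) - M t $$ (i, j)) * x i * x j)
          \<le> (\<Sum>i<n. \<Sum>j<n. e * (((x i)\<^sup>2 + (x j)\<^sup>2) / 2))"
        by (intro sum_mono) auto
      also have "\<dots> = e * n * ?N"
        by (simp add: sum_distrib_left[symmetric] sum_divide_distrib[symmetric] sum.distrib
            sum_distrib_right[symmetric])
      also have "\<dots> < c * ?N" using e(2) N by simp
      also have "\<dots> \<le> (\<Sum>i<n. \<Sum>j<n. M t0 $$ (i, j) * x i * x j)" by (rule c(2))
      finally show ?thesis by (simp add: left_diff_distrib sum_subtractf)
    qed
    moreover have "\<forall>i<n. \<forall>j<n. M t $$ (i, j) = M t $$ (j, i)"
      using M[of t] by (metis carrier_matD index_transpose_mat(1))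
    ultimately show "pd n (M t)"
      using pd_iff[OF M(1)] by blast
  qed
qed

section \<open>Evaluation of nc polynomials\<close>

lemma word_eval_carrier [simp]:
  assumes "\<And>l. X l \<in> carrier_mat n n"
  shows "word_eval n X u \<in> carrier_mat n n"
  by (induction u) (use assms in \<open>auto simp: word_eval_def intro!: mult_carrier_mat\<close>)

lemma word_eval_Nil: "i < n \<Longrightarrow> j < n \<Longrightarrow> word_eval n X [] $$ (i, j) = (if i = j then 1 else 0)"
  by (simp add: word_eval_def)

lemma word_eval_Cons:
  assumes "\<And>l. X l \<in> carrier_mat n n" "i < n" "j < n"
  shows "word_eval n X (l # u) $$ (i, j) = (\<Sum>k<n. X l $$ (i, k) * word_eval n X u $$ (k, j))"
proof -
  have "word_eval n X (l # u) = X l * word_eval n X u" by (simp add: word_eval_def)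
  moreover have "word_eval n X u \<in> carrier_mat n n" using assms(1) by simp
  ultimately show ?thesis
    using assms(1)[of l] assms(2,3) by (auto simp: scalar_prod_def atLeast0LessThan intro!: sum.cong)
qed

lemma word_eval_append:
  assumes "\<And>l. X l \<in> carrier_mat n n"
  shows "word_eval n X (u @ v) = word_eval n X u * word_eval n X v"
proof (induction u)
  case Nil
  show ?case using word_eval_carrier[of X n v, OF assms] by (simp add: word_eval_def)
next
  case (Cons l u)
  have "word_eval n X (l # u @ v) = X l * (word_eval n X u * word_eval n X v)"
    using Cons by (simp add: word_eval_def)
  also have "\<dots> = X l * word_eval n X u * word_eval n X v"
    using assms by (intro assoc_mult_mat[symmetric, of _ n n _ n _ n]) auto
  finally show ?case by (simp add: word_eval_def)
qed

lemma transpose_word_eval: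
  assumes "X \<in> sym_tuples n"
  shows "transpose_mat (word_eval n X u) = word_eval n X (rev u)"
proof (induction u)
  case Nil
  show ?case by (simp add: word_eval_def)
next
  case (Cons l u)
  have X: "\<And>l. X l \<in> carrier_mat n n" "\<And>l. transpose_mat (X l) = X l"
    using assms by (auto simp: sym_tuples_def)
  have "transpose_mat (word_eval n X (l # u)) = transpose_mat (X l * word_eval n X u)"
    by (simp add: word_eval_def)
  also have "\<dots> = word_eval n X (rev u) * X l"
    using transpose_mult[OF X(1)[of l] word_eval_carrier[of X n u, OF X(1)]] Cons X(2) by simp
  also have "X l = word_eval n X [l]"
    using X(1)[of l] by (simp add: word_eval_def)
  finally show ?case by (simp add: word_eval_append[OF X(1)])
qed

lemma lookup_rev:
  assumes "nc_symmetric p"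
  shows "Poly_Mapping.lookup p (rev u) = Poly_Mapping.lookup p u"
  using assms lookup_nc_invol[of p u] by (simp add: nc_symmetric_def)

lemma sum_keys_rev:
  assumes "nc_symmetric p"
  shows "(\<Sum>u\<in>Poly_Mapping.keys p. f (rev u)) = (\<Sum>u\<in>Poly_Mapping.keys p. f u)"
  by (rule sum.reindex_bij_witness[of _ rev rev]) (auto simp: in_keys_iff lookup_rev[OF assms])

lemma transpose_nc_eval:
  assumes "nc_symmetric p" "X \<in> sym_tuples n"
  shows "transpose_mat (nc_eval n p X) = nc_eval n p X"
proof (rule eq_matI)
  fix i j assume "i < dim_row (nc_eval n p X)" "j < dim_col (nc_eval n p X)"
  then have ij: "i < n" "j < n" by (simp_all add: nc_eval_def)
  have X: "\<And>l. X l \<in> carrier_mat n n" using assms(2) by (simp add: sym_tuples_def)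
  have "word_eval n X u $$ (j, i) = word_eval n X (rev u) $$ (i, j)" for u
    using word_eval_carrier[of X n u, OF X] ij transpose_word_eval[OF assms(2), of u, symmetric] by simp
  then have "(\<Sum>u\<in>Poly_Mapping.keys p. Poly_Mapping.lookup p u * word_eval n X u $$ (j, i))
      = (\<Sum>u\<in>Poly_Mapping.keys p. Poly_Mapping.lookup p (rev u) * word_eval n X (rev u) $$ (i, j))"
    by (simp add: lookup_rev[OF assms(1)])
  then show "transpose_mat (nc_eval n p X) $$ (i, j) = nc_eval n p X $$ (i, j)"
    using ij by (simp add: nc_eval_def
        sum_keys_rev[OF assms(1), of "\<lambda>u. Poly_Mapping.lookup p u * word_eval n X u $$ (i, j)"])
qed (simp_all add: nc_eval_def)

lemma continuous_on_word_eval: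
  assumes "\<And>t l. X t l \<in> carrier_mat n n"
    and "\<And>l i j. i < n \<Longrightarrow> j < n \<Longrightarrow> continuous_on UNIV (\<lambda>t. X t l $$ (i, j))"
    and "i < n" "j < n"
  shows "continuous_on UNIV (\<lambda>t. word_eval n (X t) u $$ (i, j))"
  using assms(3)
proof (induction u arbitrary: i)
  case Nil
  then show ?case using assms(4) by (simp add: word_eval_Nil)
next
  case (Cons l u)
  then show ?case
    using assms(4) by (auto simp: word_eval_Cons[OF assms(1)] intro!: continuous_intros assms(2))
qed

text \<open>Entries of evaluations are polynomials in the entries of the point, so the openness of positive
  definiteness passes to basic open sets, along any continuous family of points.\<close>

lemma eventually_in_nc_basic_open:
  fixes X :: "'a::t2_space \<Rightarrow> 'g \<Rightarrow> real mat"
  assumes ps: "\<forall>q\<in>set ps. nc_symmetric q"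
    and X: "\<And>t. X t \<in> sym_tuples n"
    and cont: "\<And>l i j. i < n \<Longrightarrow> j < n \<Longrightarrow> continuous_on UNIV (\<lambda>t. X t l $$ (i, j))"
    and t0: "\<forall>q\<in>set ps. pd n (nc_eval n q (X t0))"
  shows "\<forall>\<^sub>F t in nhds t0. \<forall>q\<in>set ps. pd n (nc_eval n q (X t))"
proof (intro eventually_ball_finite ballI finite_set)
  fix q assume q: "q \<in> set ps"
  have carr: "\<And>t l. X t l \<in> carrier_mat n n" using X by (simp add: sym_tuples_def)
  show "\<forall>\<^sub>F t in nhds t0. pd n (nc_eval n q (X t))"
  proof (rule eventually_pd)
    show "nc_eval n q (X t) \<in> carrier_mat n n" for t by (simp add: nc_eval_def)
    show "transpose_mat (nc_eval n q (X t)) = nc_eval n q (X t)" for t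
      using ps q X by (intro transpose_nc_eval) auto
    show "continuous_on UNIV (\<lambda>t. nc_eval n q (X t) $$ (i, j))" if "i < n" "j < n" for i j
      using that by (auto simp: nc_eval_def intro!: continuous_intros continuous_on_word_eval carr cont)
    show "pd n (nc_eval n q (X t0))" using t0 q by simp
  qed
qed

section \<open>Kronecker sums\<close>

text \<open>The Kronecker sum of an \<open>n\<close> by \<open>n\<close> matrix \<open>A\<close> and a \<open>d\<close> by \<open>d\<close> matrix \<open>S\<close>. The index \<open>i * n + a\<close>
  stands for the pair of the block \<open>i\<close> and the position \<open>a\<close> in it.\<close>

definition kron_sum :: "nat \<Rightarrow> nat \<Rightarrow> real mat \<Rightarrow> (nat \<Rightarrow> nat \<Rightarrow> real) \<Rightarrow> real mat" where
  "kron_sum d n A S = mat (d * n) (d * n) (\<lambda>(r, s).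
     (if r div n = s div n then A $$ (r mod n, s mod n) else 0)
   + (if r mod n = s mod n then S (r div n) (s div n) else 0))"

lemma kron_sum_carrier [simp]: "kron_sum d n A S \<in> carrier_mat (d * n) (d * n)"
  by (simp add: kron_sum_def)

lemma block_index_less:
  fixes i a :: nat
  assumes "i < d" "a < n" shows "i * n + a < d * n"
proof -
  have "i * n + a < Suc i * n" using assms by simp
  also have "\<dots> \<le> d * n" using assms by (intro mult_le_mono1) simp
  finally show ?thesis .
qed

lemma kron_sum_index:
  assumes "i < d" "j < d" "a < n" "b < n"
  shows "kron_sum d n A S $$ (i * n + a, j * n + b) =
    (if i = j then A $$ (a, b) else 0) + (if a = b then S i j else 0)"
  using assms by (simp add: kron_sum_def block_index_less)

lemma sum_blocks: "(\<Sum>r<d * n. f r) = (\<Sum>i<d. \<Sum>a<n. f (i * n + a :: nat))"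
proof -
  have "sum f {i * n..<i * n + n} = (\<Sum>a<n. f (i * n + a))" for i
    by (rule sum.reindex_bij_witness[of _ "\<lambda>a. i * n + a" "\<lambda>r. r - i * n"]) auto
  then show ?thesis by (simp add: sum.nat_group[symmetric])
qed

lemma block_index_cases:
  fixes r :: nat
  assumes "r < d * n"
  obtains i a where "i < d" "a < n" "r = i * n + a"
proof
  have n: "0 < n" using assms by (cases n) auto
  show "r div n < d" using assms by (simp add: less_mult_imp_div_less)
  show "r mod n < n" using n by simp
  show "r = r div n * n + r mod n" by simp
qed

lemma kron_sum_sym_tuples:
  assumes "X \<in> sym_tuples n" "\<And>l i j. S l i j = S l j i"
  shows "(\<lambda>l. kron_sum d n (X l) (S l)) \<in> sym_tuples (d * n)"
proof -
  have X: "X l \<in> carrier_mat n n" "transpose_mat (X l) = X l" for l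
    using assms(1) by (auto simp: sym_tuples_def)
  have sym: "X l $$ (a, b) = X l $$ (b, a)" if "a < n" "b < n" for l a b
    using X[of l] that by (metis carrier_matD index_transpose_mat(1))
  have "transpose_mat (kron_sum d n (X l) (S l)) = kron_sum d n (X l) (S l)" for l
  proof (rule eq_matI)
    fix r s assume "r < dim_row (kron_sum d n (X l) (S l))" "s < dim_col (kron_sum d n (X l) (S l))"
    then have rs: "r < d * n" "s < d * n" by (simp_all add: kron_sum_def)
    then have "0 < n" by (cases n) auto
    then show "transpose_mat (kron_sum d n (X l) (S l)) $$ (r, s) = kron_sum d n (X l) (S l) $$ (r, s)"
      using rs by (simp add: kron_sum_def sym[of "r mod n" "s mod n"] assms(2)[of l "r div n"])
  qed (simp_all add: kron_sum_def)
  then show ?thesis by (simp add: sym_tuples_def)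
qed

lemma word_eval_ampliation:
  assumes X: "\<And>l. X l \<in> carrier_mat n n"
    and "i < d" "j < d" "a < n" "b < n"
  shows "word_eval (d * n) (\<lambda>l. kron_sum d n (X l) (\<lambda>_ _. 0)) u $$ (i * n + a, j * n + b)
    = (if i = j then word_eval n X u $$ (a, b) else 0)"
  using assms(2,4)
proof (induction u arbitrary: i a)
  case Nil
  have "i * n + a = j * n + b \<longleftrightarrow> i = j \<and> a = b"
    using Nil assms(5) by (metis add.commute div_mult_self3 div_less add_0 mod_mult_self3 mod_less less_nat_zero_code)
  then show ?case using Nil assms by (simp add: word_eval_Nil block_index_less)
next
  case (Cons l u)
  let ?Y = "\<lambda>l. kron_sum d n (X l) (\<lambda>_ _. 0)"
  have "word_eval (d * n) ?Y (l # u) $$ (i * n + a, j * n + b)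
      = (\<Sum>k<d. \<Sum>e<n. (if i = k then X l $$ (a, e) else 0) * (if k = j then word_eval n X u $$ (e, b) else 0))"
    using Cons assms(3,5)
    by (subst word_eval_Cons) (simp_all add: block_index_less sum_blocks kron_sum_index)
  also have "\<dots> = (\<Sum>k<d. if k = i then (if i = j then \<Sum>e<n. X l $$ (a, e) * word_eval n X u $$ (e, b) else 0) else 0)"
    by (intro sum.cong) auto
  also have "\<dots> = (if i = j then word_eval n X (l # u) $$ (a, b) else 0)"
    using Cons.prems assms(5) by (simp add: word_eval_Cons[OF X])
  finally show ?case .
qed

text \<open>For \<open>S = 0\<close> the Kronecker sum is a direct sum of \<open>d\<close> copies, and so is its evaluation: the
  quadratic form is a sum of \<open>d\<close> copies of that of \<open>nc_eval n q X\<close> in separate variables.\<close>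

lemma pd_ampliation:
  assumes X: "X \<in> sym_tuples n" and q: "nc_symmetric q" and pd: "pd n (nc_eval n q X)"
  shows "pd (d * n) (nc_eval (d * n) q (\<lambda>l. kron_sum d n (X l) (\<lambda>_ _. 0)))"
proof -
  let ?Y = "\<lambda>l. kron_sum d n (X l) (\<lambda>_ _. 0)"
  let ?M = "nc_eval n q X" and ?N = "nc_eval (d * n) q ?Y"
  have Xc: "\<And>l. X l \<in> carrier_mat n n" using X by (simp add: sym_tuples_def)
  have carr: "?M \<in> carrier_mat n n" "?N \<in> carrier_mat (d * n) (d * n)"
    by (simp_all add: nc_eval_def)
  have entry: "?N $$ (i * n + a, j * n + b) = (if i = j then ?M $$ (a, b) else 0)"
    if "i < d" "j < d" "a < n" "b < n" for i j a b
    using that by (simp add: nc_eval_def block_index_less word_eval_ampliation[OF Xc])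
  have Ypd: "transpose_mat ?N = ?N"
    by (intro transpose_nc_eval q kron_sum_sym_tuples X) simp
  have "0 < (\<Sum>r<d * n. \<Sum>s<d * n. ?N $$ (r, s) * x r * x s)" if nz: "\<exists>r<d * n. x r \<noteq> 0" for x
  proof -
    let ?Q = "\<lambda>i. \<Sum>a<n. \<Sum>b<n. ?M $$ (a, b) * x (i * n + a) * x (i * n + b)"
    have "(\<Sum>r<d * n. \<Sum>s<d * n. ?N $$ (r, s) * x r * x s)
        = (\<Sum>i<d. \<Sum>a<n. \<Sum>j<d. if j = i then \<Sum>b<n. ?M $$ (a, b) * x (i * n + a) * x (i * n + b) else 0)"
      unfolding sum_blocks by (intro sum.cong refl) (auto simp: entry)
    also have "\<dots> = (\<Sum>i<d. ?Q i)" by simp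
    finally have eq: "(\<Sum>r<d * n. \<Sum>s<d * n. ?N $$ (r, s) * x r * x s) = (\<Sum>i<d. ?Q i)" .
    have pos: "0 < ?Q i" if "\<exists>a<n. x (i * n + a) \<noteq> 0" for i
      using pd pd_iff[OF carr(1)] that by (auto dest!: spec[of _ "\<lambda>a. x (i * n + a)"])
    have nonneg: "0 \<le> ?Q i" for i
    proof (cases "\<exists>a<n. x (i * n + a) \<noteq> 0")
      case True
      then show ?thesis using pos by (simp add: less_imp_le)
    qed simp
    obtain i a where "i < d" "a < n" "x (i * n + a) \<noteq> 0"
      using nz by (metis block_index_cases)
    then show ?thesis
      unfolding eq using pos nonneg by (intro sum_pos2[of "{..<d}" i]) auto
  qed
  moreover have "\<forall>r<d * n. \<forall>s<d * n. ?N $$ (r, s) = ?N $$ (s, r)"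
    using Ypd carr(2) by (metis carrier_matD index_transpose_mat(1))
  ultimately show ?thesis using pd_iff[OF carr(2)] by blast
qed

section \<open>Kronecker sums with a labelled cycle\<close>

definition cycle_tuple ::
  "nat \<Rightarrow> ('g \<Rightarrow> real mat) \<Rightarrow> 'g list \<Rightarrow> (nat \<Rightarrow> real) \<Rightarrow> real \<Rightarrow> 'g \<Rightarrow> real mat" where
  "cycle_tuple n X w c b = (\<lambda>l. kron_sum (length w) n (X l) (cycle_adj w c b l))"

lemma word_eval_cycle_tuple:
  assumes "k < length w" "a < n"
  shows "word_eval (length w * n) (cycle_tuple n X w c b) u $$ (k * n + a, 0)
    = walk_sum (\<lambda>l a b. X l $$ (a, b)) n w c b u k a"
  using assms
proof (induction u arbitrary: k a)
  case Nil
  then have "0 < length w * n" by (metis gr0I less_nat_zero_code mult_is_0)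
  then show ?case using Nil by (simp add: word_eval_Nil block_index_less)
next
  case (Cons l u)
  let ?d = "length w" and ?Y = "cycle_tuple n X w c b"
  let ?T = "walk_sum (\<lambda>l a b. X l $$ (a, b)) n w c b u"
  have "0 < ?d * n" using Cons.prems by (metis gr0I less_nat_zero_code mult_is_0)
  then have "word_eval (?d * n) ?Y (l # u) $$ (k * n + a, 0)
      = (\<Sum>i<?d. \<Sum>e<n. ((if k = i then X l $$ (a, e) else 0)
          + (if a = e then cycle_adj w c b l k i else 0)) * ?T i e)"
    using Cons
    by (subst word_eval_Cons)
      (simp_all add: block_index_less sum_blocks kron_sum_index cycle_tuple_def)
  also have "\<dots> = (\<Sum>i<?d. (if i = k then \<Sum>e<n. X l $$ (a, e) * ?T k e else 0)
      + (\<Sum>e<n. if e = a then cycle_adj w c b l k i * ?T i a else 0))"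
    unfolding distrib_right sum.distrib
    by (intro arg_cong2[where f = "(+)"] sum.cong refl) auto
  also have "\<dots> = walk_sum (\<lambda>l a b. X l $$ (a, b)) n w c b (l # u) k a"
    using Cons.prems by (simp add: sum.distrib walk_sum.simps(2))
  finally show ?case .
qed

lemma cycle_tuple_sym:
  assumes "X \<in> sym_tuples n"
  shows "cycle_tuple n X w c b \<in> sym_tuples (length w * n)"
  unfolding cycle_tuple_def
  by (rule kron_sum_sym_tuples[OF assms]) (auto simp: cycle_adj_def)

text \<open>The tuples depend affinely on the weights, so a segment between two of them stays in the family
  and its membership in a set is a question about weights.\<close>

lemma conv_comb_cycle_tuple:
  "conv_comb s (cycle_tuple n X w c b) (cycle_tuple n X w c' b')
    = cycle_tuple n X w (\<lambda>j. s * c j + (1 - s) * c' j) (s * b + (1 - s) * b')"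
proof
  fix l
  have "s * (x + y) + (1 - s) * (x + y') = x + (s * y + (1 - s) * y')" for x y y' :: real
    by (simp add: algebra_simps)
  moreover have "s * cycle_adj w c b l i j + (1 - s) * cycle_adj w c' b' l i j
      = cycle_adj w (\<lambda>j. s * c j + (1 - s) * c' j) (s * b + (1 - s) * b') l i j" for i j
  proof -
    have if_lin: "s * (if P then x else 0) + (1 - s) * (if P then y else 0)
        = (if P then s * x + (1 - s) * y else 0)" for P and x y :: real
      by simp
    show ?thesis
      unfolding cycle_adj_def if_lin[symmetric] by (simp only: distrib_left)
  qed
  ultimately show "conv_comb s (cycle_tuple n X w c b) (cycle_tuple n X w c' b') l
    = cycle_tuple n X w (\<lambda>j. s * c j + (1 - s) * c' j) (s * b + (1 - s) * b') l"
    unfolding conv_comb_def cycle_tuple_def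
    by (intro eq_matI) (auto simp: kron_sum_def algebra_simps)
qed

lemma continuous_on_if_const:
  assumes "continuous_on S f" "continuous_on S g"
  shows "continuous_on S (\<lambda>t. if P then f t else g t)"
  using assms by (cases P) auto

lemma psd_diag:
  assumes "psd n A" "i < n"
  shows "0 \<le> A $$ (i, i)"
proof -
  have A: "A \<in> carrier_mat n n" using assms by (simp add: psd_def)
  have "0 \<le> scalar_prod (unit_vec n i) (A *\<^sub>v unit_vec n i)"
    using assms by (simp add: psd_def)
  also have "\<dots> = A $$ (i, i)"
    using A assms(2) by (simp add: scalar_prod_left_unit)
  finally show ?thesis .
qed

lemma nc_eval_cycle_tuple:
  assumes "0 < n" "w \<noteq> []"
  shows "nc_eval (length w * n) p (cycle_tuple n X w c b) $$ (0, 0)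
    = (\<Sum>u\<in>Poly_Mapping.keys p. Poly_Mapping.lookup p u *
        walk_sum (\<lambda>l a b. X l $$ (a, b)) n w c b u 0 0)"
  using assms word_eval_cycle_tuple[of 0 w 0 n X c b] by (simp add: nc_eval_def)

text \<open>The weights range over a three-parameter family, and the openness lemma is applied
  around the zero weights, where the tuple is a direct sum of copies of \<open>X\<close>.\<close>

lemma cycle_tuples_in_nc_basic_open:
  assumes \<O>: "nc_basic_open \<O>" and "0 < n" "X \<in> \<O> n" "w \<noteq> []"
  shows "\<exists>e>0. \<forall>al ga b. \<bar>al\<bar> < e \<and> \<bar>ga\<bar> < e \<and> \<bar>b\<bar> < e \<longrightarrow>
    cycle_tuple n X w (\<lambda>j. if j = length w - 2 then ga else al) b \<in> \<O> (length w * n)"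
proof -
  let ?N = "length w * n"
  obtain ps where ps: "\<forall>q\<in>set ps. nc_symmetric q"
    and \<O>_eq: "\<And>n. 0 < n \<Longrightarrow> \<O> n = {X \<in> sym_tuples n. \<forall>q\<in>set ps. pd n (nc_eval n q X)}"
    using \<O> unfolding nc_basic_open_def by blast
  define Y :: "real \<times> real \<times> real \<Rightarrow> _" where
    "Y t = cycle_tuple n X w (\<lambda>j. if j = length w - 2 then fst (snd t) else fst t) (snd (snd t))" for t
  have N: "0 < ?N" using assms by simp
  have X: "X \<in> sym_tuples n" "\<forall>q\<in>set ps. pd n (nc_eval n q X)"
    using assms \<O>_eq by auto
  have Y: "Y t \<in> sym_tuples ?N" for t
    unfolding Y_def by (intro cycle_tuple_sym X)
  have "\<forall>\<^sub>F t in nhds (0, 0, 0). \<forall>q\<in>set ps. pd ?N (nc_eval ?N q (Y t))"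
  proof (rule eventually_in_nc_basic_open[OF ps Y])
    show "continuous_on UNIV (\<lambda>t. Y t l $$ (i, j))" if "i < ?N" "j < ?N" for l i j
      using that unfolding Y_def cycle_tuple_def kron_sum_def cycle_adj_def
      by (simp only: index_mat(1) prod.case) (intro continuous_intros continuous_on_if_const)
    have "cycle_adj w (\<lambda>_. 0) 0 l = (\<lambda>_ _. 0)" for l
      by (intro ext) (simp add: cycle_adj_def)
    then have "Y (0, 0, 0) = (\<lambda>l. kron_sum (length w) n (X l) (\<lambda>_ _. 0))"
      by (simp add: Y_def cycle_tuple_def cong: if_cong)
    then show "\<forall>q\<in>set ps. pd ?N (nc_eval ?N q (Y (0, 0, 0)))"
      using pd_ampliation[OF X(1)] X(2) ps by simp
  qed
  then obtain e where e: "0 < e"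
    "\<And>t. dist t (0, 0, 0) < e \<Longrightarrow> \<forall>q\<in>set ps. pd ?N (nc_eval ?N q (Y t))"
    unfolding eventually_nhds_metric by blast
  have "cycle_tuple n X w (\<lambda>j. if j = length w - 2 then ga else al) b \<in> \<O> ?N"
    if "\<bar>al\<bar> < e / 3" "\<bar>ga\<bar> < e / 3" "\<bar>b\<bar> < e / 3" for al ga b
  proof -
    have "dist (al, ga, b) (0, 0, 0) \<le> \<bar>al\<bar> + (\<bar>ga\<bar> + \<bar>b\<bar>)"
      using norm_Pair_le[of al "(ga, b)"] norm_Pair_le[of ga b] by (simp add: dist_norm)
    also have "\<dots> < e" using that by linarith
    finally have "Y (al, ga, b) \<in> \<O> ?N" using e(2) Y \<O>_eq[OF N] by blast
    then show ?thesis by (simp add: Y_def cong: if_cong)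
  qed
  then show ?thesis using e(1) by (intro exI[of _ "e / 3"]) auto
qed

text \<open>Words shorter than \<open>w\<close> have no first order term. Among those of the length of \<open>w\<close> only \<open>w\<close> and its
  reversal have one; if \<open>w\<close> is a palindrome, the two directions around the cycle both spell it,
  so the factor \<open>2\<close> remains.\<close>

lemma closing_derivative_sum:
  fixes p :: "'g ncpoly"
  assumes "nc_symmetric p" "\<And>u. u \<in> Poly_Mapping.keys p \<Longrightarrow> length u \<le> length w" "2 \<le> length w"
  shows "((\<lambda>b. \<Sum>u\<in>Poly_Mapping.keys p. Poly_Mapping.lookup p u * walk_sum A n w c b u 0 0)
    has_real_derivative 2 * Poly_Mapping.lookup p w * (\<Prod>j<length w - 1. c j)) (at 0)"
proof -
  let ?K = "Poly_Mapping.keys p" and ?p = "Poly_Mapping.lookup p" and ?P = "\<Prod>j<length w - 1. c j"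
  have w: "0 < length w" using assms(3) by linarith
  have "((\<lambda>b. \<Sum>u\<in>?K. ?p u * walk_sum A n w c b u 0 0) has_real_derivative
      (\<Sum>u\<in>?K. ?p u * ((if u = rev w then ?P else 0) + (if u = w then ?P else 0)))) (at 0)"
  proof (intro DERIV_sum DERIV_cmult)
    fix u assume "u \<in> ?K"
    then have u: "length u \<le> length w" by (rule assms(2))
    have eq: "rev u = take (length w - 0) w \<longleftrightarrow> u = rev w" by auto
    have "(if length u + 0 < length w \<or> (0::nat) \<noteq> 0 then 0
       else (if rev u = take (length w - 0) w then \<Prod>j=0..<length w - 1. c j else 0)
          + (if (0::nat) = 0 \<and> u = w then ?P else 0))
      = (if u = rev w then ?P else 0) + (if u = w then ?P else 0)"
    proof (cases "length u < length w")
      case True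
      then have "u \<noteq> rev w" "u \<noteq> w" by auto
      with True show ?thesis by simp
    next
      case False
      then show ?thesis unfolding eq atLeast0LessThan by (simp only: add_0_right simp_thms if_False if_True)
    qed
    with walk_sum_closing_derivative[OF w, of u A n c 0] u assms(3)
    show "((\<lambda>b. walk_sum A n w c b u 0 0) has_real_derivative
        (if u = rev w then ?P else 0) + (if u = w then ?P else 0)) (at 0)"
      by (simp only: add_0_right)
  qed
  also have "(\<Sum>u\<in>?K. ?p u * ((if u = rev w then ?P else 0) + (if u = w then ?P else 0)))
      = (\<Sum>u\<in>?K. if u = rev w then ?p u * ?P else 0) + (\<Sum>u\<in>?K. if u = w then ?p u * ?P else 0)"
    unfolding sum.distrib[symmetric] by (intro sum.cong) auto
  also have "\<dots> = ?p (rev w) * ?P + ?p w * ?P"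
    by (simp add: sum.delta in_keys_iff)
  also have "\<dots> = 2 * ?p w * ?P"
    by (simp add: lookup_rev[OF assms(1)])
  finally show ?thesis .
qed

section \<open>Convexity fails in degree above two\<close>

theorem theorem71:
  fixes p :: "'g::finite ncpoly" and \<O> :: "nat \<Rightarrow> ('g \<Rightarrow> real mat) set"
  assumes "nc_symmetric p"
    and "nc_basic_open \<O>"
    and "nc_nonempty \<O>"
    and "nc_convex_on p \<O>"
  shows "nc_degree p \<le> 2"
proof (rule ccontr)
  let ?K = "Poly_Mapping.keys p" and ?p = "Poly_Mapping.lookup p"
  assume "\<not> nc_degree p \<le> 2"
  then have "p \<noteq> 0" by (auto simp: nc_degree_def)
  with \<open>\<not> nc_degree p \<le> 2\<close> have deg: "2 < Max (length ` ?K)"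
    unfolding nc_degree_def not_le by (simp only: if_False)
  have "Max (length ` ?K) \<in> length ` ?K" using \<open>p \<noteq> 0\<close> by (intro Max_in) auto
  then obtain w where w: "w \<in> ?K" "length w = Max (length ` ?K)" by auto
  have d: "2 < length w" and longest: "\<And>u. u \<in> ?K \<Longrightarrow> length u \<le> length w"
    using deg w(2) by auto
  obtain n X where n: "0 < n" "X \<in> \<O> n"
    using assms(3) unfolding nc_nonempty_def by blast
  let ?N = "length w * n"
  define wt where "wt al ga = (\<lambda>j. if j = length w - 2 then ga else al)" for al ga :: real
  obtain e where e: "0 < e" and in_\<O>:
    "\<And>al ga b. \<bar>al\<bar> < e \<Longrightarrow> \<bar>ga\<bar> < e \<Longrightarrow> \<bar>b\<bar> < e \<Longrightarrow> cycle_tuple n X w (wt al ga) b \<in> \<O> ?N"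
    using cycle_tuples_in_nc_basic_open[OF assms(2) n, of w] d unfolding wt_def by fastforce
  define al where "al = e / 2"
  have al: "0 < al" "al < e" using e by (simp_all add: al_def)
  define f where "f ga b = (\<Sum>u\<in>?K. ?p u * walk_sum (\<lambda>l a b. X l $$ (a, b)) n w (wt al ga) b u 0 0)"
    for ga b
  have f_eval: "nc_eval ?N p (cycle_tuple n X w (wt al ga) b) $$ (0, 0) = f ga b" for ga b
    unfolding f_def using n(1) d by (intro nc_eval_cycle_tuple) auto
  have f_deriv: "(f ga has_real_derivative 2 * ?p w * (ga * al ^ (length w - 2))) (at 0)" for ga
  proof -
    have "{..<length w - 1} = insert (length w - 2) {..<length w - 2}" using d by auto
    then have "(\<Prod>j<length w - 1. wt al ga j) = ga * al ^ (length w - 2)"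
      by (simp add: wt_def)
    then show ?thesis
      using closing_derivative_sum[OF assms(1) longest, where c = "wt al ga"] d
      unfolding f_def by fastforce
  qed
  have f_0: "f ga 0 = f 0 0" for ga
    unfolding f_def
  proof (intro sum.cong refl arg_cong2[where f = "(*)"] walk_sum_last_edge_irrelevant)
    fix u assume "u \<in> ?K"
    with longest[OF this] d show "length u + 0 < 2 * (length w - 1)" by linarith
  qed (use d in \<open>auto simp: wt_def\<close>)
  \<comment> \<open>Twice the convexity defect at the midpoint of the tuples with weights \<open>(al, b)\<close> and
    \<open>(- al, - b)\<close>, seen in the top left entry.\<close>
  define F where "F b = f al b + f (- al) (- b) - 2 * f 0 0" for b
  have mirrored: "((\<lambda>b. f (- al) (- b)) has_real_derivative
      - (2 * ?p w * (- al * al ^ (length w - 2)))) (at 0)"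
    using DERIV_mirror[of "f (- al)" "2 * ?p w * (- al * al ^ (length w - 2))" 0] f_deriv[of "- al"]
    by simp
  have "(F has_real_derivative
      2 * ?p w * (al * al ^ (length w - 2)) + - (2 * ?p w * (- al * al ^ (length w - 2))) - 0) (at 0)"
    unfolding F_def
    by (intro DERIV_diff DERIV_add f_deriv mirrored DERIV_const)
  then have F_deriv: "(F has_real_derivative 4 * ?p w * (al * al ^ (length w - 2))) (at 0)"
    by (simp add: mult.assoc mult.left_commute)
  have "0 \<le> F b" if b: "\<bar>b\<bar> < e" for b
  proof -
    let ?Y = "cycle_tuple n X w (wt al al) b" and ?Z = "cycle_tuple n X w (wt al (- al)) (- b)"
    have seg: "conv_comb s ?Y ?Z = cycle_tuple n X w (wt al ((2 * s - 1) * al)) ((2 * s - 1) * b)" for s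
    proof -
      have "(\<lambda>j. s * wt al al j + (1 - s) * wt al (- al) j) = wt al ((2 * s - 1) * al)"
        by (auto simp: wt_def algebra_simps)
      moreover have "s * b + (1 - s) * - b = (2 * s - 1) * b" by (simp add: algebra_simps)
      ultimately show ?thesis by (simp only: conv_comb_cycle_tuple)
    qed
    have "\<forall>s\<in>{0..1}. conv_comb s ?Y ?Z \<in> \<O> ?N"
    proof
      fix s :: real assume "s \<in> {0..1}"
      then have s: "\<bar>2 * s - 1\<bar> \<le> 1" by auto
      have "\<bar>(2 * s - 1) * y\<bar> < e" if "\<bar>y\<bar> < e" for y
        using mult_right_mono[OF s, of "\<bar>y\<bar>"] that by (simp add: abs_mult)
      then show "conv_comb s ?Y ?Z \<in> \<O> ?N"
        unfolding seg using al b by (intro in_\<O>) auto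
    qed
    moreover have "?Y \<in> \<O> ?N" "?Z \<in> \<O> ?N" using al b by (auto intro!: in_\<O>)
    moreover have N: "0 < ?N" using n(1) d by auto
    moreover have "(1 / 2 :: real) \<in> {0..1}" by simp
    ultimately have "psd ?N ((1 / 2) \<cdot>\<^sub>m nc_eval ?N p ?Y + (1 - 1 / 2) \<cdot>\<^sub>m nc_eval ?N p ?Z
        - nc_eval ?N p (conv_comb (1 / 2) ?Y ?Z))"
      using assms(4) unfolding nc_convex_on_def by blast
    from psd_diag[OF this N]
    have "0 \<le> (1 / 2) * nc_eval ?N p ?Y $$ (0, 0) + (1 - 1 / 2) * nc_eval ?N p ?Z $$ (0, 0)
        - nc_eval ?N p (conv_comb (1 / 2) ?Y ?Z) $$ (0, 0)"
      using N by (simp add: nc_eval_def)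
    then show ?thesis unfolding seg by (simp add: f_eval F_def)
  qed
  moreover have "F 0 = 0" using f_0[of al] f_0[of "- al"] by (simp add: F_def)
  ultimately have "4 * ?p w * (al * al ^ (length w - 2)) = 0"
    using DERIV_local_min[OF F_deriv e] by (simp add: abs_minus_commute)
  then show False using al w(1) by (simp add: in_keys_iff)
qed

end
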